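(* Let $\alpha\ge0$, $\beta\ge0$ and $\lambda,\mu>0$ be real numbers such that $\lambda+\mu\ge1$. Then for every positive integer $n$, $$\sin x+\sum_{k=2}^n\frac{\sin kx}{(k+\alpha)^{\lambda}(k+\beta)^{\mu}}>0,\qquad x\in(0,\pi).$$
   Context: For $n=1$ the sum over $k$ is empty. *)

theory Defs
  imports Complex_Main
begin

end

theory Submission
  imports Defs
begin

text \<open>
  Write \<open>a 1 = 1\<close> and \<open>a k = (k + \<alpha>) powr - lam * (k + \<beta>) powr - mu\<close> for \<open>k \<ge> 2\<close>.  If
  \<open>lam + mu = 1\<close>, then \<open>a k\<close> decreases, while \<open>k * a k\<close>, being a product of powers of
  \<open>k / (k + \<alpha>)\<close> and \<open>k / (k + \<beta>)\<close>, increases for \<open>k \<ge> 2\<close> and is at most \<open>1\<close>.  These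
  properties alone make the sine sum positive (theorem \<open>sine_sum_pos\<close>); each of the two
  monotonicity properties settles one part of the interval.

  Away from \<open>pi\<close> the monotonicity of \<open>a\<close> is used.  The conjugate Dirichlet kernel
  \<open>\<Sum>k=1..m. sin (k * x)\<close> is at least \<open>- tan (x/4) / 2\<close>, so by partial summation the terms with
  \<open>k \<ge> 2\<close> contribute at least \<open>a 2 * (- tan (x/4) / 2 - sin x)\<close>, and \<open>a 2 \<le> 1/2\<close>.  The first
  term outweighs this as long as \<open>cos (x/2) \<ge> 1/4\<close>.

  Close to \<open>pi\<close> the monotonicity of \<open>k * a k\<close> is used.  Put \<open>x = pi - y\<close>.  Then \<open>sin (k * x) / k\<close>
  is the difference of two consecutive remainders of the Fourier series of the sawtooth
  \<open>y / 2\<close>.  Once the first term is subtracted, all remainders are smaller than \<open>sin y / 2\<close> in absolute value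
  (lemma \<open>sawtooth_remainder_bound\<close>), so partial summation with the weights
  \<open>k * a k \<le> 1\<close> shows that the terms with \<open>k \<ge> 2\<close> contribute more than \<open>- sin y = - sin x\<close>.

  The case \<open>lam + mu = s > 1\<close> follows from the exponents \<open>lam / s\<close> and \<open>mu / s\<close>: passing from
  the coefficients \<open>a k\<close> to \<open>a k powr s\<close> multiplies them by the decreasing sequence
  \<open>a k powr (s - 1)\<close>, and by partial summation this keeps the sum positive.
\<close>

section \<open>Partial summation\<close>

lemma weighted_sum_ge:
  fixes c d :: "nat \<Rightarrow> real"
  assumes "m \<le> n"
    and nonneg: "\<And>k. m \<le> k \<Longrightarrow> 0 \<le> c k"
    and decr: "\<And>k. m \<le> k \<Longrightarrow> c (Suc k) \<le> c k"
    and partial: "\<And>k. m \<le> k \<Longrightarrow> k \<le> n \<Longrightarrow> L \<le> (\<Sum>i=m..k. d i)"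
  shows "c m * L \<le> (\<Sum>k=m..n. c k * d k)"
proof -
  have "j \<le> n \<longrightarrow> c m * L + c j * ((\<Sum>i=m..j. d i) - L) \<le> (\<Sum>k=m..j. c k * d k)"
    if "m \<le> j" for j
    using that
  proof (induction j rule: dec_induct)
    case base
    then show ?case by (simp add: algebra_simps)
  next
    case (step j)
    show ?case
    proof
      assume "Suc j \<le> n"
      have "c (Suc j) * ((\<Sum>i=m..j. d i) - L) \<le> c j * ((\<Sum>i=m..j. d i) - L)"
        using decr[of j] partial[of j] step.hyps \<open>Suc j \<le> n\<close> by (intro mult_right_mono) auto
      then show "c m * L + c (Suc j) * ((\<Sum>i=m..Suc j. d i) - L) \<le> (\<Sum>k=m..Suc j. c k * d k)"
        using step.IH step.hyps \<open>Suc j \<le> n\<close> by (simp add: algebra_simps)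
    qed
  qed
  moreover have "0 \<le> c n * ((\<Sum>i=m..n. d i) - L)"
    using nonneg[of n] partial[of n] \<open>m \<le> n\<close> by simp
  ultimately show ?thesis
    using \<open>m \<le> n\<close> by fastforce
qed

lemma weighted_sum_pos:
  fixes c d :: "nat \<Rightarrow> real"
  assumes "m \<le> n"
    and pos: "\<And>k. m \<le> k \<Longrightarrow> 0 < c k"
    and "\<And>k. m \<le> k \<Longrightarrow> c (Suc k) \<le> c k"
    and partial: "\<And>k. m \<le> k \<Longrightarrow> k \<le> n \<Longrightarrow> 0 < (\<Sum>i=m..k. d i)"
  shows "0 < (\<Sum>k=m..n. c k * d k)"
proof -
  define L where "L = Min ((\<lambda>k. \<Sum>i=m..k. d i) ` {m..n})"
  have "0 < L"
    using \<open>m \<le> n\<close> partial unfolding L_def by (subst Min_gr_iff) auto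
  then have "0 < c m * L"
    using pos[of m] by simp
  also have "\<dots> \<le> (\<Sum>k=m..n. c k * d k)"
    using assms by (intro weighted_sum_ge) (auto simp: L_def less_imp_le)
  finally show ?thesis .
qed

text \<open>
  With increasing weights \<open>g\<close> every increment of \<open>g\<close> is multiplied by a single value of \<open>e\<close>, and
  the last weight meets \<open>- e (n + 1)\<close>.  The two contributions together cost at most
  \<open>2 * g n * C\<close>.
\<close>

lemma weighted_differences_gt:
  fixes e g :: "nat \<Rightarrow> real"
  assumes "m \<le> n"
    and pos: "\<And>k. m \<le> k \<Longrightarrow> 0 < g k"
    and incr: "\<And>k. m \<le> k \<Longrightarrow> g k \<le> g (Suc k)"
    and bound: "\<And>k. m \<le> k \<Longrightarrow> \<bar>e k\<bar> < C"
  shows "- (2 * g n * C) < (\<Sum>k=m..n. g k * (e k - e (Suc k)))"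
proof -
  have "- (g n * C) \<le> (\<Sum>k=m..n. g k * (e k - e (Suc k))) + g n * e (Suc n)"
    using \<open>m \<le> n\<close>
  proof (induction n rule: dec_induct)
    case base
    have "g m * (- C) \<le> g m * e m"
      using pos[of m] bound[of m] by (intro mult_left_mono) auto
    then show ?case by (simp add: algebra_simps)
  next
    case (step j)
    have "(g (Suc j) - g j) * (- C) \<le> (g (Suc j) - g j) * e (Suc j)"
      using incr[of j] bound[of "Suc j"] step.hyps by (intro mult_left_mono) auto
    then show ?case
      using step by (simp add: algebra_simps)
  qed
  moreover have "g n * e (Suc n) < g n * C"
    using pos[of n] bound[of "Suc n"] \<open>m \<le> n\<close> by (intro mult_strict_left_mono) auto
  ultimately show ?thesis by simp
qed

section \<open>Away from pi: the conjugate Dirichlet kernel\<close>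

lemma conj_dirichlet_kernel:
  fixes x :: real
  shows "2 * sin (x/2) * (\<Sum>k=1..m. sin (real k * x)) = cos (x/2) - cos ((real m + 1/2) * x)"
proof (induction m)
  case 0
  then show ?case by simp
next
  case (Suc m)
  have "2 * sin (x/2) * sin (real (Suc m) * x)
      = cos ((real m + 1/2) * x) - cos ((real (Suc m) + 1/2) * x)"
    using sin_times_sin[of "real (Suc m) * x" "x/2"] by (simp add: algebra_simps add_divide_distrib)
  then show ?case
    using Suc by (simp add: algebra_simps)
qed

lemma sine_sum_pos_away_from_pi:
  fixes a :: "nat \<Rightarrow> real"
  assumes x: "0 < x" "x < pi" "1/4 \<le> cos (x/2)"
    and "n \<ge> 1" and a1: "a 1 = 1"
    and pos: "\<And>k. 1 \<le> k \<Longrightarrow> 0 < a k"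
    and decr: "\<And>k. 1 \<le> k \<Longrightarrow> a (Suc k) \<le> a k"
    and a2: "2 * a 2 \<le> 1"
  shows "0 < (\<Sum>k=1..n. a k * sin (real k * x))"
proof (cases "n = 1")
  case True
  then show ?thesis using a1 x sin_gt_zero by simp
next
  case False
  then have "2 \<le> n" using \<open>n \<ge> 1\<close> by simp
  define s where "s = sin (x/2)"
  define c where "c = cos (x/2)"
  have s: "0 < s" unfolding s_def using x by (intro sin_gt_zero) auto
  have c: "1/4 \<le> c" "c \<le> 1" using x by (auto simp: c_def)
  have sx: "sin x = 2 * s * c"
    using sin_double[of "x/2"] by (simp add: s_def c_def)
  have s2: "s * s = 1 - c * c"
    using sin_squared_eq[of "x/2"] by (simp add: s_def c_def power2_eq_square)
  define L where "L = - ((1 - c) / (2 * s)) - sin x"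
  have "L \<le> (\<Sum>k=2..m. sin (real k * x))" if "2 \<le> m" for m
  proof -
    have "2 * s * (\<Sum>k=1..m. sin (real k * x)) \<ge> c - 1"
      using conj_dirichlet_kernel[of x m] cos_le_one[of "(real m + 1/2) * x"]
      unfolding s_def c_def by linarith
    then have "(c - 1) / (2 * s) \<le> (\<Sum>k=1..m. sin (real k * x))"
      using s by (simp add: field_simps)
    moreover have "(\<Sum>k=1..m. sin (real k * x)) = sin x + (\<Sum>k=2..m. sin (real k * x))"
      using that by (simp add: sum.atLeast_Suc_atMost numeral_2_eq_2)
    ultimately show ?thesis by (simp add: L_def diff_divide_distrib)
  qed
  then have tail: "a 2 * L \<le> (\<Sum>k=2..n. a k * sin (real k * x))"
    using \<open>2 \<le> n\<close> pos decr by (intro weighted_sum_ge) (auto intro: less_imp_le)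
  have "1 - c < 2 * s * sin x"
  proof -
    \<comment> \<open>After multiplication by \<open>2 * s\<close> the required inequality has the factor \<open>1 - c\<close>
      in common; what remains is \<open>4 * c * (1 + c) > 1\<close>.\<close>
    have "2 * s * sin x = 4 * c * (s * s)" by (simp add: sx)
    also have "\<dots> = 4 * c * (1 + c) * (1 - c)" unfolding s2 by (simp add: algebra_simps)
    finally have factored: "2 * s * sin x = 4 * c * (1 + c) * (1 - c)" .
    have "c \<noteq> 1" using s s2 by auto
    moreover have "1 < 4 * c * (1 + c)"
    proof -
      have "(1/4) * (1 + 1/4) \<le> c * (1 + c)" using c by (intro mult_mono) auto
      then show ?thesis by simp
    qed
    ultimately have "1 * (1 - c) < 4 * c * (1 + c) * (1 - c)"
      using c by (intro mult_strict_right_mono) auto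
    then show ?thesis unfolding factored by simp
  qed
  then have "(1 - c) / (2 * s) < sin x"
    using s by (simp add: field_simps)
  then have "- (2 * sin x) < L" by (simp add: L_def)
  then have "a 2 * (- (2 * sin x)) < a 2 * L"
    using pos[of 2] by (intro mult_strict_left_mono) auto
  moreover have "a 2 * 2 * sin x \<le> 1 * sin x"
    using a2 x sin_gt_zero[of x] by (intro mult_right_mono) auto
  moreover have "(\<Sum>k=1..n. a k * sin (real k * x)) = sin x + (\<Sum>k=2..n. a k * sin (real k * x))"
    using \<open>2 \<le> n\<close> a1 by (simp add: sum.atLeast_Suc_atMost numeral_2_eq_2)
  ultimately show ?thesis using tail by simp
qed

section \<open>Close to pi: remainders of the sawtooth series\<close>

definition sawtooth_remainder :: "nat \<Rightarrow> real \<Rightarrow> real" where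
  "sawtooth_remainder m y = y / 2 - (\<Sum>k=1..<m. (-1) ^ Suc k * sin (real k * y) / real k)"

lemma alternating_dirichlet_kernel:
  fixes y :: real
  assumes "1 \<le> m"
  shows "2 * cos (y/2) * (1/2 - (\<Sum>k=1..<m. (-1) ^ Suc k * cos (real k * y)))
    = (-1) ^ Suc m * cos ((real m - 1/2) * y)"
  using assms
proof (induction m rule: dec_induct)
  case base
  then show ?case by simp
next
  case (step m)
  have "2 * cos (y/2) * cos (real m * y) = cos ((real m - 1/2) * y) + cos ((real (Suc m) - 1/2) * y)"
    using cos_times_cos[of "real m * y" "y/2"] by (simp add: algebra_simps add_divide_distrib)
  then have "2 * cos (y/2) * ((-1) ^ Suc m * cos (real m * y))
      = (-1) ^ Suc m * (cos ((real m - 1/2) * y) + cos ((real (Suc m) - 1/2) * y))"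
    by (metis mult.left_commute)
  then show ?case
    using step by (simp add: algebra_simps)
qed

lemma sawtooth_remainder_deriv:
  assumes "1 \<le> m" "0 < cos (y/2)"
  shows "(sawtooth_remainder m has_real_derivative
    (-1) ^ Suc m * cos ((real m - 1/2) * y) / (2 * cos (y/2))) (at y)"
proof -
  have "(sawtooth_remainder m has_real_derivative
      (1/2 - (\<Sum>k=1..<m. (-1) ^ Suc k * cos (real k * y)))) (at y)"
    unfolding sawtooth_remainder_def[abs_def]
    by (auto intro!: derivative_eq_intros sum.cong)
  also have "1/2 - (\<Sum>k=1..<m. (-1) ^ Suc k * cos (real k * y))
      = (-1) ^ Suc m * cos ((real m - 1/2) * y) / (2 * cos (y/2))"
    using alternating_dirichlet_kernel[OF assms(1), of y] assms(2) by (simp add: field_simps)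
  finally show ?thesis .
qed

lemma sawtooth_remainder_0 [simp]: "sawtooth_remainder m 0 = 0"
  by (simp add: sawtooth_remainder_def)

lemma cos_half_pos: "0 \<le> y \<Longrightarrow> y < pi \<Longrightarrow> 0 < cos (y/2)" for y :: real
  by (intro cos_gt_zero_pi) auto

text \<open>
  Before the first zero of \<open>cos ((m - 1/2) * t)\<close> the derivatives can be compared directly:
  \<open>m \<ge> 2\<close> gives \<open>cos ((m - 1/2) * t) \<le> cos (3 * t / 2) < cos t * cos (t / 2)\<close>.
\<close>

lemma sawtooth_remainder_bound_small:
  assumes m: "2 \<le> m" and y: "0 < y" "y < pi" and small: "(real m - 1/2) * y \<le> pi/2"
  shows "\<bar>sawtooth_remainder m y\<bar> < sin y / 2"
proof -
  define p where "p = real m - 1/2"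
  have p: "3/2 \<le> p" using m by (simp add: p_def)
  have main: "\<sigma> * sawtooth_remainder m y < sin y / 2" if \<sigma>: "\<bar>\<sigma>\<bar> = 1" for \<sigma> :: real
  proof -
    let ?f = "\<lambda>t. sin t / 2 - \<sigma> * sawtooth_remainder m t"
    have deriv: "(?f has_real_derivative
        cos t / 2 - \<sigma> * ((-1) ^ Suc m * cos (p * t) / (2 * cos (t/2)))) (at t)"
      if "0 \<le> t" "t \<le> y" for t
      unfolding p_def using that m y
      by (auto intro!: derivative_eq_intros sawtooth_remainder_deriv cos_half_pos)
    have "?f 0 < ?f y"
    proof (rule DERIV_pos_imp_increasing_open[where f = ?f])
      fix t assume t: "0 < t" "t < y"
      have "p * t \<le> p * y" using t p by (intro mult_left_mono) auto
      then have pt: "p * t \<le> pi/2" using small by (simp add: p_def)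
      have "3/2 * t \<le> p * t" using t p by (intro mult_right_mono) auto
      have h: "0 < cos (t/2)" using t y by (intro cos_half_pos) auto
      have "0 \<le> p * t" using t p by simp
      then have "cos (p * t) \<ge> 0" using pt by (intro cos_ge_zero) auto
      then have "\<sigma> * ((-1) ^ Suc m * cos (p * t)) \<le> cos (p * t)"
        using abs_ge_self[of "\<sigma> * ((-1) ^ Suc m * cos (p * t))"] \<sigma> by (simp add: abs_mult power_abs)
      also have "\<dots> \<le> cos (3/2 * t)"
        using \<open>3/2 * t \<le> p * t\<close> pt t pi_gt_zero by (intro cos_monotone_0_pi_le) linarith+
      also have "\<dots> = cos t * cos (t/2) - sin t * sin (t/2)"
        using cos_add[of t "t/2"] by (simp add: field_simps)
      also have "\<dots> < cos t * cos (t/2)"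
        using t y by (simp add: sin_gt_zero)
      finally have "\<sigma> * ((-1) ^ Suc m * cos (p * t)) / (2 * cos (t/2)) < cos t / 2"
        using h by (simp add: field_simps)
      then have "0 < cos t / 2 - \<sigma> * ((-1) ^ Suc m * cos (p * t) / (2 * cos (t/2)))"
        by simp
      moreover have "0 \<le> t" "t \<le> y" using t by auto
      ultimately show "\<exists>z. (?f has_real_derivative z) (at t) \<and> 0 < z"
        using deriv by blast
    next
      show "continuous_on {0..y} ?f"
        using deriv by (intro DERIV_atLeastAtMost_imp_continuous_on) blast
    qed (use y in auto)
    then show ?thesis by simp
  qed
  show ?thesis
    using main[of 1] main[of "-1"] by (simp add: abs_less_iff)
qed

text \<open>
  This is integration by parts: integrating the factor \<open>cos ((m - 1/2) * t)\<close> of the derivative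
  gains \<open>1 / (m - 1/2)\<close>, and the total variation of the other factor \<open>1 / (2 * cos (t/2))\<close> on
  \<open>{0..y}\<close> is the difference of its values at the end points.  The boundary term and the
  variation add up to \<open>1 / cos (y/2) - 1/2\<close>.
\<close>

lemma sawtooth_remainder_le_inverse:
  assumes m: "1 \<le> m" and y: "0 \<le> y" "y < pi"
  shows "\<bar>sawtooth_remainder m y\<bar> \<le> (1 / cos (y/2) - 1/2) / (real m - 1/2)"
proof -
  define p where "p = real m - 1/2"
  define \<tau> :: real where "\<tau> = (-1) ^ Suc m"
  have p: "0 < p" using m by (simp add: p_def)
  have \<tau>: "\<bar>\<tau>\<bar> = 1" by (simp add: \<tau>_def power_abs)
  define h where "h t = 1 / (2 * cos (t/2))" for t :: real
  define h' where "h' t = sin (t/2) / (2 * cos (t/2))\<^sup>2" for t :: real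
  define f where "f t = sawtooth_remainder m t - \<tau> * h t * sin (p * t) / p" for t
  have dh: "(h has_real_derivative h' t) (at t)" if "0 \<le> t" "t \<le> y" for t
    unfolding h_def h'_def using cos_half_pos[of t] that y
    by (auto intro!: derivative_eq_intros simp: power2_eq_square)
  have df: "(f has_real_derivative - (\<tau> * h' t * sin (p * t) / p)) (at t)"
    if "0 \<le> t" "t \<le> y" for t
  proof -
    have "(f has_real_derivative
        (-1) ^ Suc m * cos ((real m - 1/2) * t) / (2 * cos (t/2))
        - (\<tau> * h' t * sin (p * t) + \<tau> * h t * (cos (p * t) * p)) / p) (at t)"
      unfolding f_def using that y m p
      by (auto intro!: derivative_eq_intros sawtooth_remainder_deriv cos_half_pos dh
          simp: field_simps)
    moreover have "(-1) ^ Suc m * cos ((real m - 1/2) * t) / (2 * cos (t/2))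
        - (\<tau> * h' t * sin (p * t) + \<tau> * h t * (cos (p * t) * p)) / p
        = - (\<tau> * h' t * sin (p * t) / p)"
      using p unfolding \<tau>_def[symmetric] p_def[symmetric]
      by (simp add: h_def add_divide_distrib)
    ultimately show ?thesis by simp
  qed
  have main: "\<sigma> * f y \<le> (h y - 1/2) / p" if \<sigma>: "\<bar>\<sigma>\<bar> = 1" for \<sigma> :: real
  proof -
    let ?g = "\<lambda>t. h t / p - \<sigma> * f t"
    have "?g 0 \<le> ?g y"
    proof (rule DERIV_nonneg_imp_nondecreasing[where f = ?g])
      fix t assume t: "0 \<le> t" "t \<le> y"
      have "(?g has_real_derivative h' t / p - \<sigma> * (- (\<tau> * h' t * sin (p * t) / p))) (at t)"
        using t p by (auto intro!: derivative_eq_intros dh df)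
      moreover have "0 \<le> h' t / p - \<sigma> * (- (\<tau> * h' t * sin (p * t) / p))"
      proof -
        have "0 \<le> h' t" using t y by (auto simp: h'_def intro!: divide_nonneg_nonneg sin_ge_zero)
        moreover have "\<bar>\<sigma> * \<tau> * sin (p * t)\<bar> \<le> 1" using \<sigma> \<tau> by (simp add: abs_mult)
        ultimately have "0 \<le> h' t * (1 + \<sigma> * \<tau> * sin (p * t))"
          by (intro mult_nonneg_nonneg) (auto simp: abs_le_iff)
        then show ?thesis using p by (simp add: field_simps)
      qed
      ultimately show "\<exists>z. (?g has_real_derivative z) (at t) \<and> 0 \<le> z" by blast
    qed (use y in auto)
    then show ?thesis by (simp add: f_def h_def diff_divide_distrib)
  qed
  have "\<bar>f y\<bar> \<le> (h y - 1/2) / p"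
    using main[of 1] main[of "-1"] by (simp add: abs_le_iff)
  moreover have "\<bar>\<tau> * h y * sin (p * y) / p\<bar> \<le> h y / p"
  proof -
    have "0 < h y" using cos_half_pos[of y] y by (simp add: h_def)
    then show ?thesis using \<tau> p by (simp add: abs_mult divide_right_mono mult_left_le)
  qed
  ultimately have "\<bar>sawtooth_remainder m y\<bar> \<le> (h y - 1/2) / p + h y / p"
    unfolding f_def by linarith
  also have "\<dots> = (1 / cos (y/2) - 1/2) / p"
    unfolding add_divide_distrib[symmetric] by (simp add: h_def)
  finally show ?thesis by (simp add: p_def)
qed

lemma mult_cos_le_sin: "u * cos u \<le> sin u" if "0 \<le> u" "u \<le> pi" for u :: real
proof -
  have "(\<lambda>t. sin t - t * cos t) 0 \<le> (\<lambda>t. sin t - t * cos t) u"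
  proof (rule DERIV_nonneg_imp_nondecreasing[where f = "\<lambda>t. sin t - t * cos t"])
    fix t assume "0 \<le> t" "t \<le> u"
    then have "((\<lambda>t. sin t - t * cos t) has_real_derivative t * sin t) (at t) \<and> 0 \<le> t * sin t"
      using that by (auto intro!: derivative_eq_intros mult_nonneg_nonneg sin_ge_zero)
    then show "\<exists>z. ((\<lambda>t. sin t - t * cos t) has_real_derivative z) (at t) \<and> 0 \<le> z" by blast
  qed fact
  then show ?thesis by simp
qed

lemma pi_ge_3: "3 \<le> pi"
  using sin_x_le_x[of "pi/6"] by (simp add: sin_30)

text \<open>
  Beyond the first zero of the derivative, \<open>1 / (m - 1/2)\<close> is below \<open>2 * y / pi\<close>, so the
  integrated bound is linear in \<open>y\<close>.  Its slope is less than \<open>1/2\<close> with enough room for crude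
  numerical estimates, while \<open>sin y / 2\<close> has slope close to \<open>1/2\<close> for such small \<open>y\<close>.
\<close>

lemma sawtooth_remainder_bound:
  assumes m: "2 \<le> m" and y: "0 < y" "y < pi" and "sin (y/2) \<le> 1/4"
  shows "\<bar>sawtooth_remainder m y\<bar> < sin y / 2"
proof (cases "(real m - 1/2) * y \<le> pi/2")
  case True
  then show ?thesis using sawtooth_remainder_bound_small m y by blast
next
  case False
  define p where "p = real m - 1/2"
  define c where "c = cos (y/2)"
  have p: "0 < p" using m by (simp add: p_def)
  have c: "0 < c" "c \<le> 1" using cos_half_pos y by (auto simp: c_def)
  have "(sin (y/2))\<^sup>2 \<le> (1/4)\<^sup>2"
    using assms by (intro power_mono) (auto intro: sin_ge_zero)
  then have c2: "15/16 \<le> c * c"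
    using sin_squared_eq[of "y/2"] by (simp add: c_def power2_eq_square)
  moreover have "c * c \<le> c" using c by (simp add: mult_left_le)
  ultimately have c1: "15/16 \<le> c" by simp
  have "\<bar>sawtooth_remainder m y\<bar> \<le> (1 / c - 1/2) / p"
    using sawtooth_remainder_le_inverse[of m y] m y by (simp add: c_def p_def)
  \<comment> \<open>The constant is \<open>16/15 - 1/2\<close>, from \<open>c \<ge> 15/16\<close>.\<close>
  also have "\<dots> \<le> (17/30) / p"
    using c1 c p by (intro divide_right_mono) (auto simp: field_simps)
  also have "\<dots> < (17/30) * (2 * y / 3)"
    using False pi_ge_3 p by (simp add: p_def[symmetric] field_simps)
  also have "\<dots> \<le> 15/16 * y / 2" using y by simp
  also have "\<dots> \<le> c * c * y / 2" using c2 y by (intro divide_right_mono mult_right_mono) auto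
  also have "\<dots> \<le> sin y / 2"
  proof -
    have "c * (y / 2 * c) \<le> c * sin (y/2)"
      using mult_cos_le_sin[of "y/2"] y c by (intro mult_left_mono) (auto simp: c_def)
    moreover have "sin y = 2 * sin (y/2) * c"
      using sin_double[of "y/2"] by (simp add: c_def)
    ultimately show ?thesis by (simp add: algebra_simps)
  qed
  finally show ?thesis .
qed

lemma sine_sum_pos_close_to_pi:
  fixes a :: "nat \<Rightarrow> real"
  assumes x: "0 < x" "x < pi" "cos (x/2) \<le> 1/4"
    and "n \<ge> 1" and a1: "a 1 = 1"
    and pos: "\<And>k. 1 \<le> k \<Longrightarrow> 0 < a k"
    and incr: "\<And>k. 2 \<le> k \<Longrightarrow> real k * a k \<le> real (Suc k) * a (Suc k)"
    and le1: "\<And>k. 2 \<le> k \<Longrightarrow> real k * a k \<le> 1"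
  shows "0 < (\<Sum>k=1..n. a k * sin (real k * x))"
proof (cases "n = 1")
  case True
  then show ?thesis using a1 x sin_gt_zero by simp
next
  case False
  then have n: "2 \<le> n" using \<open>n \<ge> 1\<close> by simp
  define y where "y = pi - x"
  have y: "0 < y" "y < pi" using x by (auto simp: y_def)
  have "sin (y/2) = cos (x/2)"
    by (simp add: y_def diff_divide_distrib sin_diff)
  then have "sin (y/2) \<le> 1/4"
    using x by simp
  then have bound: "\<bar>sawtooth_remainder k y\<bar> < sin y / 2" if "2 \<le> k" for k
    using sawtooth_remainder_bound that y by blast
  have sin_y: "sin y = sin x" "0 < sin x" using x by (auto simp: y_def sin_gt_zero)
  have summand: "a k * sin (real k * x)
      = real k * a k * (sawtooth_remainder k y - sawtooth_remainder (Suc k) y)" if "2 \<le> k" for k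
  proof -
    have "sin (real k * x) = sin (real k * pi - real k * y)"
      by (simp add: y_def algebra_simps)
    also have "\<dots> = (-1) ^ Suc k * sin (real k * y)"
      by (simp add: sin_diff cos_npi)
    finally show ?thesis using that by (simp add: sawtooth_remainder_def)
  qed
  have "real n * a n * sin x \<le> 1 * sin x"
    using le1[OF n] sin_y by (intro mult_right_mono) auto
  then have "- sin x \<le> - (2 * (real n * a n) * (sin y / 2))"
    by (simp add: sin_y)
  also have "\<dots> < (\<Sum>k=2..n. real k * a k * (sawtooth_remainder k y - sawtooth_remainder (Suc k) y))"
  proof (rule weighted_differences_gt[where e = "\<lambda>k. sawtooth_remainder k y"
        and g = "\<lambda>k. real k * a k"])
    show "0 < real k * a k" if "2 \<le> k" for k
      using pos[of k] that by simp
  qed (use n in \<open>simp_all only: incr bound\<close>)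
  also have "\<dots> = (\<Sum>k=2..n. a k * sin (real k * x))"
    by (intro sum.cong) (auto simp: summand)
  finally show ?thesis
    using n a1 by (simp add: sum.atLeast_Suc_atMost numeral_2_eq_2)
qed

section \<open>Positive sine sums\<close>

theorem sine_sum_pos:
  fixes a :: "nat \<Rightarrow> real"
  assumes "0 < x" "x < pi" and "n \<ge> 1" and "a 1 = 1"
    and "\<And>k. 1 \<le> k \<Longrightarrow> 0 < a k"
    and "\<And>k. 1 \<le> k \<Longrightarrow> a (Suc k) \<le> a k"
    and "\<And>k. 2 \<le> k \<Longrightarrow> real k * a k \<le> real (Suc k) * a (Suc k)"
    and le1: "\<And>k. 2 \<le> k \<Longrightarrow> real k * a k \<le> 1"
  shows "0 < (\<Sum>k=1..n. a k * sin (real k * x))"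
proof (cases "1/4 \<le> cos (x/2)")
  case True
  then show ?thesis using assms le1[of 2] by (intro sine_sum_pos_away_from_pi) auto
next
  case False
  then show ?thesis using assms by (intro sine_sum_pos_close_to_pi) auto
qed

theorem theorem3p2:
  fixes \<alpha> \<beta> lam mu x :: real and n :: nat
  assumes "\<alpha> \<ge> 0" and "\<beta> \<ge> 0"
    and "lam > 0" and "mu > 0" and "lam + mu \<ge> 1"
    and "n \<ge> 1"
    and "x \<in> {0<..<pi}"
  shows "sin x + (\<Sum>k = 2..n. sin (real k * x) /
           ((real k + \<alpha>) powr lam * (real k + \<beta>) powr mu)) > 0"
proof -
  define s where "s = lam + mu"
  define l where "l = lam / s"
  define r where "r = mu / s"
  have s: "1 \<le> s" and lr: "0 < l" "0 < r" "l + r = 1" and ls: "l * s = lam" "r * s = mu"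
    using assms by (auto simp: s_def l_def r_def add_divide_distrib[symmetric])
  define a where "a k = (if k \<le> 1 then 1 else 1 / ((real k + \<alpha>) powr l * (real k + \<beta>) powr r))"
    for k :: nat
  have a1: "a 1 = 1"
    by (simp add: a_def)
  have pos: "0 < a k" for k
    using assms by (auto simp: a_def)
  then have nz: "a k \<noteq> 0" for k
    by (metis less_irrefl)
  have ka: "real k * a k = (k / (k + \<alpha>)) powr l * (k / (k + \<beta>)) powr r" if "2 \<le> k" for k
  proof -
    have "real k = real k powr l * real k powr r"
      using that lr by (simp flip: powr_add)
    then have "real k * a k
        = real k powr l * real k powr r / ((real k + \<alpha>) powr l * (real k + \<beta>) powr r)"
      using that by (simp add: a_def)
    then show ?thesis
      using that assms by (simp add: powr_divide)
  qed
  have frac_mono: "real k / (real k + t) \<le> real (Suc k) / (real (Suc k) + t)" if "0 \<le> t" "2 \<le> k" for k t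
    using that by (simp add: field_simps)
  have decr: "a (Suc k) \<le> a k" for k
  proof -
    have "1 \<le> (real (Suc k) + \<alpha>) powr l * (real (Suc k) + \<beta>) powr r"
      using mult_mono[of 1 "(real (Suc k) + \<alpha>) powr l" 1 "(real (Suc k) + \<beta>) powr r"] assms lr
      by (simp add: ge_one_powr_ge_zero)
    moreover have "(real k + \<alpha>) powr l * (real k + \<beta>) powr r
        \<le> (real (Suc k) + \<alpha>) powr l * (real (Suc k) + \<beta>) powr r"
      using assms lr by (intro mult_mono powr_mono2) auto
    ultimately show ?thesis
      using assms by (auto simp: a_def intro!: divide_left_mono mult_pos_pos)
  qed
  have base: "0 < (\<Sum>k=1..m. a k * sin (real k * x))" if "1 \<le> m" for m
  proof (rule sine_sum_pos)
    fix k :: nat assume k: "2 \<le> k"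
    show "real k * a k \<le> real (Suc k) * a (Suc k)"
      unfolding ka[OF k] ka[OF le_SucI[OF k]] using assms lr k frac_mono[of \<alpha> k] frac_mono[of \<beta> k]
      by (intro mult_mono powr_mono2) auto
    show "real k * a k \<le> 1"
      unfolding ka[OF k] using assms lr k by (intro mult_le_one powr_le1) auto
  qed (use assms that pos decr a1 in auto)
  have "0 < (\<Sum>k=1..n. a k powr (s - 1) * (a k * sin (real k * x)))"
    proof (rule weighted_sum_pos[where d = "\<lambda>k. a k * sin (real k * x)"])
    show "a (Suc k) powr (s - 1) \<le> a k powr (s - 1)" for k
      using s decr by (intro powr_mono2) (auto intro: less_imp_le[OF pos])
    show "0 < a k powr (s - 1)" for k
      using nz by simp
  qed (use \<open>n \<ge> 1\<close> base in blast)+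
  also have "\<dots> = (\<Sum>k=1..n. a k powr s * sin (real k * x))"
    using nz by (intro sum.cong) (simp_all add: powr_diff abs_of_pos[OF pos])
  also have "\<dots> = sin x + (\<Sum>k=2..n. a k powr s * sin (real k * x))"
    using assms by (simp add: sum.atLeast_Suc_atMost numeral_2_eq_2 a_def)
  also have "(\<Sum>k=2..n. a k powr s * sin (real k * x)) = (\<Sum>k = 2..n. sin (real k * x) /
      ((real k + \<alpha>) powr lam * (real k + \<beta>) powr mu))"
    using assms by (intro sum.cong) (auto simp: a_def powr_divide powr_mult powr_powr ls)
  finally show ?thesis .
qed

end
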